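(* Let $p_{1,3}(n)$ be defined by $\sum_{n\ge0}p_{1,3}(n)q^n=1/E_1^6$. Let $m(i,j)$ and $a(j,k)$ be the integer matrices defined below. Then for every positive integer $j$, \begin{align*} \sum_{n=0}^{\infty}p_{1,3}\left(3^{2j-1}n+\tfrac{3^{2j-1}+1}{4}\right)q^{n} &=\sum_{l=1}^{\infty}a(2j-1,l)q^{l-1}\frac{E_{3}^{12l-6}}{E_{1}^{12l}},\\ \sum_{n=0}^{\infty}p_{1,3}\left(3^{2j}n+\tfrac{3^{2j+1}+1}{4}\right)q^{n} &=\sum_{l=1}^{\infty}a(2j,l)q^{l-1}\frac{E_{3}^{12l}}{E_{1}^{12l+6}}. \end{align*}
   Context: $E_j=(q^j;q^j)_\infty=\prod_{n\ge1}(1-q^{jn})$. The matrix $\{m(i,j)\}_{i,j\ge1}$ is defined by (with $m(i,j)=0$ for $i\le0$): $m(1,1)=9$, $m(2,1)=6$, $m(3,1)=1$, $m(i,1)=0$ for $i\ge4$, and for $j\ge2$, $m(i,j)=27m(i-1,j-1)+9m(i-2,j-1)+m(i-3,j-1)$; one has $m(i,j)\ne0$ only if $\lfloor (i+2)/3\rfloor\le j\le i$. The matrix $\{a(j,k)\}_{j,k\ge1}$ is defined by $a(1,1)=6$, $a(1,2)=243$, $a(1,k)=0$ for $k\ge3$, and for $j,k\ge1$: $a(j+1,k)=\sum_{i\ge1}a(j,i)m(4i,i+k)$ if $j$ is odd, and $a(j+1,k)=\sum_{i\ge1}a(j,i)m(4i+2,i+k)$ if $j$ is even (these sums are finite). 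*)

theory Defs
  imports "HOL-Analysis.Infinite_Products" "HOL-Computational_Algebra.Formal_Power_Series"
begin

(* The q-series are formal power series over the rationals, with q = fps_X. The infinite product is
   taken in the X-adic topology; euler_prod_has_prod below shows that it converges for j > 0. *)
definition euler_prod :: "nat \<Rightarrow> rat fps" where
  "euler_prod j = (\<Prod>n. 1 - fps_X ^ (j * Suc n))"

definition p13 :: "nat \<Rightarrow> rat" where
  "p13 n = fps_nth (1 / euler_prod 1 ^ 6) n"

(* Rows and columns are numbered from 1, and row 0 and column 0 are zero. Truncated subtraction
   sends all row indices i <= 0 of the recurrence to row 0, so that m(i,j) = 0 for i <= 0. *)
fun m_mat :: "nat \<Rightarrow> nat \<Rightarrow> int" where
  "m_mat i 0 = 0"
| "m_mat i (Suc 0) = (if i = 1 then 9 else if i = 2 then 6 else if i = 3 then 1 else 0)"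
| "m_mat i (Suc (Suc j)) =
     27 * m_mat (i - 1) (Suc j) + 9 * m_mat (i - 2) (Suc j) + m_mat (i - 3) (Suc j)"

(* Only the entries with both indices at least 1 are meaningful. The sums over i >= 1 are written
   with the shifted index Suc i; m_mat_sum_finite shows that they have finitely many nonzero terms. *)
fun a_mat :: "nat \<Rightarrow> nat \<Rightarrow> int" where
  "a_mat 0 k = 0"
| "a_mat (Suc 0) k = (if k = 1 then 6 else if k = 2 then 243 else 0)"
| "a_mat (Suc (Suc j)) k =
     (if odd (Suc j)
      then (\<Sum>i. a_mat (Suc j) (Suc i) * m_mat (4 * Suc i) (Suc i + k))
      else (\<Sum>i. a_mat (Suc j) (Suc i) * m_mat (4 * Suc i + 2) (Suc i + k)))"

lemma m_mat_support: "m_mat i j \<noteq> 0 \<Longrightarrow> (i + 2) div 3 \<le> j \<and> j \<le> i"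
proof (induction i j rule: m_mat.induct)
  case (3 i j)
  then have "m_mat (i - 1) (Suc j) \<noteq> 0 \<or> m_mat (i - 2) (Suc j) \<noteq> 0 \<or> m_mat (i - 3) (Suc j) \<noteq> 0"
    by auto
  with 3 have "\<exists>d\<in>{1, 2, 3}. (i - d + 2) div 3 \<le> Suc j \<and> Suc j \<le> i - d"
    by blast
  then show ?case by auto
qed (auto split: if_splits)

lemma m_mat_sum_finite:
  "finite {i. a_mat j (Suc i) * m_mat (4 * Suc i) (Suc i + k) \<noteq> 0}"
  "finite {i. a_mat j (Suc i) * m_mat (4 * Suc i + 2) (Suc i + k) \<noteq> 0}"
proof -
  have "i \<le> 3 * k" if "m_mat (4 * Suc i) (Suc i + k) \<noteq> 0" for i
    using m_mat_support[OF that] div_less_iff_less_mult[of 3 _ "Suc (Suc i + k)"]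
    by (fastforce simp: less_Suc_eq_le[symmetric])
  then show "finite {i. a_mat j (Suc i) * m_mat (4 * Suc i) (Suc i + k) \<noteq> 0}"
    by (intro finite_subset[OF _ finite_atMost[of "3 * k"]]) auto
  have "i \<le> 3 * k" if "m_mat (4 * Suc i + 2) (Suc i + k) \<noteq> 0" for i
    using m_mat_support[OF that] div_less_iff_less_mult[of 3 _ "Suc (Suc i + k)"]
    by (fastforce simp: less_Suc_eq_le[symmetric])
  then show "finite {i. a_mat j (Suc i) * m_mat (4 * Suc i + 2) (Suc i + k) \<noteq> 0}"
    by (intro finite_subset[OF _ finite_atMost[of "3 * k"]]) auto
qed

lemma euler_prod_has_prod:
  assumes "j > 0"
  shows "(\<lambda>n. 1 - fps_X ^ (j * Suc n) :: rat fps) has_prod euler_prod j"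
    and "fps_nth (euler_prod j) 0 = 1"
proof -
  let ?f = "\<lambda>n. 1 - fps_X ^ (j * Suc n) :: rat fps"
  let ?P = "\<lambda>n. \<Prod>i\<le>n. ?f i"
  define L where "L = Abs_fps (\<lambda>k. fps_nth (?P k) k)"
  have step: "fps_nth (?P (Suc n)) k = fps_nth (?P n) k" if "k \<le> n" for n k
  proof -
    have "k < j * Suc (Suc n)"
      by (rule less_le_trans[of _ "Suc (Suc n)"]) (use that assms in \<open>simp_all del: mult_Suc_right\<close>)
    have "?P (Suc n) = ?P n - ?P n * fps_X ^ (j * Suc (Suc n))"
      by (simp only: prod.atMost_Suc right_diff_distrib mult_1_right)
    then show ?thesis
      using \<open>k < j * Suc (Suc n)\<close> by (simp only: fps_sub_nth fps_X_power_mult_right_nth) simp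
  qed
  have const: "fps_nth (?P n) k = fps_nth (?P k) k" if "k \<le> n" for n k
    using that by (induction n rule: dec_induct) (simp_all only: step)
  have lim: "?P \<longlonglongrightarrow> L"
    unfolding tendsto_fps_iff L_def
    by (auto simp: eventually_sequentially simp del: prod.atMost_Suc mult_Suc_right intro!: const)
  have L0: "fps_nth L 0 = 1"
    using assms by (simp add: L_def)
  then have "?f has_prod L"
    using lim by (auto simp: has_prod_def raw_has_prod_def)
  moreover from this have "euler_prod j = L"
    unfolding euler_prod_def by (rule has_prod_unique[symmetric])
  ultimately show "?f has_prod euler_prod j" "fps_nth (euler_prod j) 0 = 1"
    using L0 by simp_all
qed

end

theory Submission
  imports Defs "HOL-Computational_Algebra.Formal_Laurent_Series"
begin

text \<open>
  Write q for the variable. By Jacobi's identity for the cube of the Euler product,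
  E_1^3 = P(q^3) - 3 q E_9^3 for some power series P. The norm of E_1 from series in q to series
  in q^3 is E_3^4 / E_9, and taking norms of this dissection gives
  P(q^3)^3 - 27 q^3 E_9^9 = E_3^12 / E_9^3. Hence xi = q E_9^3 / E_1^3 is a root of a cubic over the
  series in q^3, namely xi^3 = y(q^3) (27 xi^2 + 9 xi + 1) with y = q E_3^12 / E_1^12, and this is
  the recurrence defining m(i,j): the terms of xi^i whose exponent is divisible by 3 add up to
  the sum of m(i,k) y(q^3)^k over k. Each eta quotient of the theorem is, up to a factor that is a
  series in q^3 and a power of q, a power of xi. So picking out a residue class of exponents modulo
  3 maps the two families of eta quotients into each other, with the coefficients m(4l, l+k) and
  m(4l+2, l+k) that define the rows of a(j,k).
\<close>

subsection \<open>Jacobi's identity for the cube of the Euler product\<close>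

(* The simproc turns equations between powers of fps_X into equations between polynomials. *)
declare [[simproc del: poly_fps_eq]]

section \<open>Continuity of the ring operations in the X-adic topology\<close>

text \<open>Convergence means that every coefficient is eventually constant, and coefficient n of a
  product depends only on the coefficients up to n of the factors.\<close>

lemma tendsto_mult_fps:
  fixes f g :: "'b \<Rightarrow> 'a :: comm_ring_1 fps"
  assumes "(f \<longlongrightarrow> a) F" "(g \<longlongrightarrow> b) F"
  shows "((\<lambda>x. f x * g x) \<longlongrightarrow> a * b) F"
proof (rule tendsto_fpsI)
  fix n
  have "eventually (\<lambda>x. \<forall>k\<in>{..n}. fps_nth (f x) k = fps_nth a k) F"
    using assms(1) unfolding tendsto_fps_iff
    by (subst eventually_ball_finite_distrib) auto
  moreover have "eventually (\<lambda>x. \<forall>k\<in>{..n}. fps_nth (g x) k = fps_nth b k) F"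
    using assms(2) unfolding tendsto_fps_iff
    by (subst eventually_ball_finite_distrib) auto
  ultimately show "eventually (\<lambda>x. fps_nth (f x * g x) n = fps_nth (a * b) n) F"
    by eventually_elim (auto simp: fps_mult_nth intro!: sum.cong)
qed

lemma tendsto_add_fps:
  fixes f g :: "'b \<Rightarrow> 'a :: comm_ring_1 fps"
  assumes "(f \<longlongrightarrow> a) F" "(g \<longlongrightarrow> b) F"
  shows "((\<lambda>x. f x + g x) \<longlongrightarrow> a + b) F"
proof (rule tendsto_fpsI)
  fix n
  show "eventually (\<lambda>x. fps_nth (f x + g x) n = fps_nth (a + b) n) F"
    using assms[unfolded tendsto_fps_iff, rule_format, of n]
    by eventually_elim auto
qed

lemma tendsto_diff_fps:
  fixes f g :: "'b \<Rightarrow> 'a :: comm_ring_1 fps"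
  assumes "(f \<longlongrightarrow> a) F" "(g \<longlongrightarrow> b) F"
  shows "((\<lambda>x. f x - g x) \<longlongrightarrow> a - b) F"
proof (rule tendsto_fpsI)
  fix n
  show "eventually (\<lambda>x. fps_nth (f x - g x) n = fps_nth (a - b) n) F"
    using assms[unfolded tendsto_fps_iff, rule_format, of n]
    by eventually_elim auto
qed

lemma tendsto_power_fps:
  fixes f :: "'b \<Rightarrow> 'a :: comm_ring_1 fps"
  assumes "(f \<longlongrightarrow> a) F"
  shows "((\<lambda>x. f x ^ n) \<longlongrightarrow> a ^ n) F"
  by (induction n) (auto intro!: tendsto_mult_fps assms)

lemma tendsto_sum_fps:
  fixes f :: "'i \<Rightarrow> 'b \<Rightarrow> 'a :: comm_ring_1 fps"
  assumes "\<And>i. i \<in> I \<Longrightarrow> (f i \<longlongrightarrow> a i) F"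
  shows "((\<lambda>x. \<Sum>i\<in>I. f i x) \<longlongrightarrow> (\<Sum>i\<in>I. a i)) F"
  using assms by (induction I rule: infinite_finite_induct) (auto intro!: tendsto_add_fps)

section \<open>Finite q-products, the Gauss binomial expansion and the finite Jacobi
  identity\<close>

definition qpoch :: "nat \<Rightarrow> rat fps" where
  "qpoch n = (\<Prod>k<n. 1 - fps_X ^ Suc k)"

lemma qpoch_0 [simp]: "qpoch 0 = 1"
  and qpoch_Suc: "qpoch (Suc n) = qpoch n * (1 - fps_X ^ Suc n)"
  by (simp_all add: qpoch_def)

lemma qpoch_nth_0 [simp]: "fps_nth (qpoch n) 0 = 1"
  by (induction n) (simp_all add: qpoch_Suc)

lemma qpoch_nonzero [simp]: "qpoch n \<noteq> 0"
  using qpoch_nth_0[of n] by (metis fps_zero_nth zero_neq_one)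

lemma euler_prod_tendsto:
  assumes "j > 0"
  shows "(\<lambda>n. \<Prod>k<n. 1 - fps_X ^ (j * Suc k)) \<longlonglongrightarrow> euler_prod j"
proof -
  have "(\<lambda>n. \<Prod>k<Suc n. 1 - fps_X ^ (j * Suc k)) \<longlonglongrightarrow> euler_prod j"
    using has_prod_imp_tendsto[OF euler_prod_has_prod(1)[OF assms]]
    by (simp only: lessThan_Suc_atMost)
  then show ?thesis by (rule LIMSEQ_imp_Suc)
qed

lemma qpoch_tendsto: "qpoch \<longlonglongrightarrow> euler_prod 1"
  using euler_prod_tendsto[of 1] by (simp add: qpoch_def[abs_def])

(* The finite form of Jacobi's identity is the derivative at X^n of the Gauss binomial expansion of
   the following product with N = 2 n + 1: only the factor with root X^n is differentiated. *)
definition qroots :: "nat \<Rightarrow> rat fps poly" where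
  "qroots N = (\<Prod>k<N. [:- (fps_X ^ k), 1:])"

lemma degree_qroots: "degree (qroots N) = N"
  unfolding qroots_def by (subst degree_prod_eq_sum_degree) auto

lemma coeff_qroots_Suc:
  "coeff (qroots (Suc N)) i = - (fps_X ^ N) * coeff (qroots N) i + (if i = 0 then 0 else coeff (qroots N) (i - 1))"
proof -
  have "qroots (Suc N) = [:- (fps_X ^ N), 1:] * qroots N"
    by (simp add: qroots_def mult.commute)
  then show ?thesis
    by (cases i) (simp_all add: coeff_pCons)
qed

lemma coeff_qroots_self: "coeff (qroots N) N = 1"
  by (induction N) (simp add: qroots_def, simp add: coeff_qroots_Suc coeff_eq_0 degree_qroots)

text \<open>The Gauss binomial theorem, with the denominators of the Gaussian coefficient cleared so
  that the induction needs no division. The induction on \<open>i + d\<close> follows the q-Pascal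
  rule of \<open>coeff_qroots_Suc\<close>.\<close>

lemma coeff_qroots:
  "coeff (qroots (i + d)) i * qpoch i * qpoch d = (-1) ^ d * fps_X ^ (d choose 2) * qpoch (i + d)"
proof (induction "i + d" arbitrary: i d)
  case 0
  then show ?case by (simp add: qroots_def binomial_eq_0)
next
  case (Suc N)
  show ?case
  proof (cases d)
    case 0
    then show ?thesis by (simp add: coeff_qroots_self binomial_eq_0)
  next
    case (Suc d')
    have T: "Suc d' choose 2 = (d' choose 2) + d'"
      by (simp add: numeral_2_eq_2)
    have N: "N = i + d'" using Suc \<open>Suc N = i + d\<close> by simp
    note IH1 = Suc.hyps(1)[OF N]
    show ?thesis
    proof (cases i)
      case 0
      have "coeff (qroots (Suc N)) 0 * qpoch (Suc d') =
         - (fps_X ^ N) * (1 - fps_X ^ Suc d') * (coeff (qroots N) 0 * qpoch 0 * qpoch d')"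
        by (simp add: coeff_qroots_Suc qpoch_Suc algebra_simps)
      then show ?thesis using IH1 N 0 Suc T
        by (simp add: qpoch_Suc power_add algebra_simps)
    next
      case i: (Suc i')
      have N': "N = i' + d" using \<open>Suc N = i + d\<close> i by simp
      note IH2 = Suc.hyps(1)[OF N']
      let ?s = "(-1) ^ d' * fps_X ^ (d' choose 2) * qpoch N"
      have 1: "coeff (qroots N) i * qpoch i * qpoch d' = ?s"
        using IH1 N by simp
      have 2: "coeff (qroots N) i' * qpoch i' * qpoch d = - (fps_X ^ d') * ?s"
        using IH2 N' Suc T by (simp add: power_add algebra_simps)
      have "coeff (qroots (Suc N)) i * qpoch i * qpoch d =
         - (fps_X ^ N) * (1 - fps_X ^ d) * (coeff (qroots N) i * qpoch i * qpoch d')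
         + (1 - fps_X ^ i) * (coeff (qroots N) i' * qpoch i' * qpoch d)"
        using i Suc by (simp add: coeff_qroots_Suc qpoch_Suc algebra_simps)
      also have "\<dots> = - (fps_X ^ d') * (1 - fps_X ^ Suc N) * ?s"
      proof -
        \<comment> \<open>As N = i + d', the two occurrences of \<open>fps_X ^ N\<close> cancel, and
          the remaining exponent N + d is d' + Suc N.\<close>
        have "- (fps_X ^ N) * (1 - fps_X ^ d) - (1 - fps_X ^ i) * fps_X ^ d' = - (fps_X ^ d') * (1 - fps_X ^ Suc N :: rat fps)"
          unfolding N using i Suc by (simp add: power_add algebra_simps)
        from arg_cong[OF this, of "\<lambda>z. z * ?s"] show ?thesis
          unfolding 1 2 by (simp add: algebra_simps)
      qed
      also have "\<dots> = (-1) ^ d * fps_X ^ (d choose 2) * qpoch (Suc N)"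
        using Suc T by (simp add: qpoch_Suc power_add algebra_simps)
      finally show ?thesis using \<open>Suc N = i + d\<close> by simp
    qed
  qed
qed

lemma qpoch_prod_upper: "(\<Prod>k<n. fps_X ^ n - fps_X ^ (n + Suc k)) = fps_X ^ (n * n) * qpoch n"
proof -
  have "(\<Prod>k<n. fps_X ^ n - fps_X ^ (n + Suc k)) = (\<Prod>k<n. fps_X ^ n * (1 - fps_X ^ Suc k) :: rat fps)"
    by (intro prod.cong refl) (simp add: power_add algebra_simps)
  then show ?thesis
    by (simp add: prod.distrib qpoch_def power_mult)
qed

lemma qpoch_prod_lower:
  "(\<Prod>k<n. fps_X ^ n - fps_X ^ k) = (-1) ^ n * fps_X ^ (n choose 2) * qpoch n"
proof -
  have "(\<Prod>k<n. fps_X ^ n - fps_X ^ k) = (\<Prod>k<n. - 1 * fps_X ^ k * (1 - fps_X ^ (n - k)) :: rat fps)"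
    by (intro prod.cong refl) (simp add: power_add[symmetric] algebra_simps)
  also have "\<dots> = (-1) ^ n * (\<Prod>k<n. fps_X ^ k) * (\<Prod>k<n. 1 - fps_X ^ (n - k))"
    by (simp only: prod.distrib) simp
  also have "(\<Prod>k<n. fps_X ^ k :: rat fps) = fps_X ^ (n choose 2)"
    by (induction n) (simp_all add: numeral_2_eq_2 power_add)
  also have "(\<Prod>k<n. 1 - fps_X ^ (n - k)) = qpoch n"
    unfolding qpoch_def by (subst prod.nat_diff_reindex[symmetric]) (auto intro!: prod.cong)
  finally show ?thesis .
qed

lemma prod_lessThan_add:
  fixes f :: "nat \<Rightarrow> 'a :: comm_monoid_mult"
  shows "(\<Prod>k<m + n. f k) = (\<Prod>k<m. f k) * (\<Prod>k<n. f (m + k))"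
  by (induction n) (simp_all add: mult_ac)

lemma sum_lessThan_add:
  fixes f :: "nat \<Rightarrow> 'a :: comm_monoid_add"
  shows "(\<Sum>k<m + n. f k) = (\<Sum>k<m. f k) + (\<Sum>k<n. f (m + k))"
  by (induction n) (simp_all add: add_ac)

text \<open>By the product rule, the derivative at a simple root is the product of the other factors
  there. \<open>fps_X ^ n\<close> is the middle one of the 2 n + 1 roots, and the n factors on
  either side of it give \<open>qpoch n\<close> up to sign and a power of X.\<close>

lemma poly_pderiv_qroots:
  "poly (pderiv (qroots (2 * n + 1))) (fps_X ^ n) =
     (-1) ^ n * fps_X ^ ((n choose 2) + n * n) * qpoch n ^ 2"
proof -
  let ?f = "\<lambda>k. [:- (fps_X ^ k), 1:] :: rat fps poly"
  have "qroots (2 * n + 1) = (\<Prod>k<Suc n. ?f k) * (\<Prod>k<n. ?f (Suc n + k))"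
    using prod_lessThan_add[of ?f "Suc n" n] by (simp add: qroots_def mult_2)
  also have "\<dots> = ?f n * ((\<Prod>k<n. ?f k) * (\<Prod>k<n. ?f (n + Suc k)))"
    by (simp add: algebra_simps)
  finally have "poly (pderiv (qroots (2 * n + 1))) (fps_X ^ n) =
     (\<Prod>k<n. fps_X ^ n - fps_X ^ k) * (\<Prod>k<n. fps_X ^ n - fps_X ^ (n + Suc k))"
    by (simp only: pderiv_mult pderiv_pCons poly_prod poly_mult poly_add) (simp add: poly_prod)
  also have "\<dots> = (-1) ^ n * fps_X ^ ((n choose 2) + n * n) * qpoch n ^ 2"
    unfolding qpoch_prod_lower qpoch_prod_upper
    by (simp add: power_add power2_eq_square algebra_simps)
  finally show ?thesis .
qed

lemma pderiv_sum: "pderiv (\<Sum>i\<in>I. f i) = (\<Sum>i\<in>I. pderiv (f i))"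
  using higher_pderiv_sum[of 1 f I] by simp

lemma poly_pderiv_sum:
  assumes "degree p \<le> N"
  shows "poly (pderiv p) x = (\<Sum>m\<le>N. of_nat m * coeff p m * x ^ (m - 1))"
proof -
  have "p = (\<Sum>m\<le>N. monom (coeff p m) m)"
    by (intro poly_eqI) (use assms in \<open>auto simp: coeff_sum coeff_eq_0\<close>)
  then have "pderiv p = pderiv (\<Sum>m\<le>N. monom (coeff p m) m)"
    by simp
  also have "\<dots> = (\<Sum>m\<le>N. monom (of_nat m * coeff p m) (m - 1))"
    by (simp add: pderiv_sum pderiv_monom)
  finally have "pderiv p = (\<Sum>m\<le>N. monom (of_nat m * coeff p m) (m - 1))" .
  then show ?thesis
    by (simp add: poly_sum poly_monom)
qed

lemma choose_two_add: "(a + b) choose 2 = (a choose 2) + (b choose 2) + a * b"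
  by (induction b) (simp_all add: numeral_2_eq_2)

text \<open>The derivative term of index m has X-exponent \<open>(d choose 2) + n * (m - 1)\<close>
  with m + d = 2 n + 1. The indices m = n + 1 + j and m = n - j lead to the same exponent, which
  exceeds that of \<open>poly_pderiv_qroots\<close> by a triangular number.\<close>

lemma coeff_qroots_exponent:
  assumes "j \<le> n"
  shows "((n - j) choose 2) + n * (n + j) = (n choose 2) + n * n + (Suc j choose 2)"
    and "j < n \<Longrightarrow> ((n + 1 + j) choose 2) + n * (n - j - 1) = (n choose 2) + n * n + (Suc j choose 2)"
proof -
  obtain d where n: "n = d + j" using assms by (metis le_add_diff_inverse2)
  have j: "Suc j choose 2 = (j choose 2) + j" by (simp add: numeral_2_eq_2)
  have jj: "2 * (j choose 2) + j = j * j" by (induction j) (simp_all add: numeral_2_eq_2)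
  show "((n - j) choose 2) + n * (n + j) = (n choose 2) + n * n + (Suc j choose 2)"
    using jj unfolding n j choose_two_add by (simp add: algebra_simps)
  assume "j < n"
  then obtain e where d: "d = Suc e" using n by (cases d) auto
  show "((n + 1 + j) choose 2) + n * (n - j - 1) = (n choose 2) + n * n + (Suc j choose 2)"
    using jj unfolding n j choose_two_add d by (simp add: algebra_simps numeral_2_eq_2)
qed

text \<open>The product form of the derivative is compared with its expansion. The terms of index n
  + 1 + j and n - j share the power of X and the Gaussian coefficient but have opposite signs, so
  their weights combine to (n + 1 + j) - (n - j) = 2 j + 1.\<close>

lemma finite_jacobi:
  "qpoch n ^ 2 = (\<Sum>j\<le>n. (-1) ^ j * of_nat (2 * j + 1) * fps_X ^ (Suc j choose 2) *
     (qpoch (2 * n + 1) * inverse (qpoch (n + 1 + j)) * inverse (qpoch (n - j))))"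
proof -
  let ?N = "2 * n + 1" and ?x = "fps_X ^ n :: rat fps"
  let ?c = "\<lambda>j. qpoch ?N * inverse (qpoch (n + 1 + j)) * inverse (qpoch (n - j))"
  let ?e = "(n choose 2) + n * n"
  define t where "t m = of_nat m * coeff (qroots ?N) m * ?x ^ (m - 1)" for m
  have coeff: "coeff (qroots ?N) i = (-1) ^ d * fps_X ^ (d choose 2) * (qpoch ?N * inverse (qpoch i) * inverse (qpoch d))"
    if "i + d = ?N" for i d
  proof -
    have "coeff (qroots ?N) i * qpoch i * qpoch d * (inverse (qpoch i) * inverse (qpoch d)) =
       (-1) ^ d * fps_X ^ (d choose 2) * qpoch ?N * (inverse (qpoch i) * inverse (qpoch d))"
      using coeff_qroots[of i d] that by simp
    moreover have "qpoch k * inverse (qpoch k) = 1" for k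
      by (simp add: inverse_mult_eq_1')
    ultimately show ?thesis
      by (simp add: mult_ac) (metis mult.left_commute mult.right_neutral)
  qed
  have pair: "t (n + 1 + j) + t (n - j) = (-1) ^ n * fps_X ^ ?e *
       ((-1) ^ j * of_nat (2 * j + 1) * fps_X ^ (Suc j choose 2) * ?c j)" if "j \<le> n" for j
  proof -
    have sgn: "(-1) ^ (n - j) = (-1 :: rat fps) ^ n * (-1) ^ j"
      using that by (metis (no_types, lifting) add_diff_inverse_nat left_minus_one_mult_self mult.commute not_less power_add)
    have "t (n + 1 + j) = of_nat (n + 1 + j) * ((-1) ^ (n - j) * fps_X ^ (((n - j) choose 2) + n * (n + j)) * ?c j)"
      unfolding t_def using coeff[of "n + 1 + j" "n - j"] that
      by (simp add: power_add power_mult[symmetric] distrib_left mult_ac)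
    then have 1: "t (n + 1 + j) = of_nat (n + 1 + j) * ((-1) ^ n * (-1) ^ j * fps_X ^ (?e + (Suc j choose 2)) * ?c j)"
      unfolding coeff_qroots_exponent(1)[OF that] sgn .
    have 2: "t (n - j) = - of_nat (n - j) * ((-1) ^ n * (-1) ^ j * fps_X ^ (?e + (Suc j choose 2)) * ?c j)"
    \<comment> \<open>For j = n the index n - j is 0, and the term vanishes through its weight; the
      exponent n - j - 1 would be truncated there.\<close>
    proof (cases "j < n")
      case True
      have "t (n - j) = of_nat (n - j) * ((-1) ^ (n + 1 + j) * fps_X ^ (((n + 1 + j) choose 2) + n * (n - j - 1)) * ?c j)"
        unfolding t_def using coeff[of "n - j" "n + 1 + j"] that
        by (simp add: power_add power_mult[symmetric] distrib_left mult_ac)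
      then show ?thesis
        unfolding coeff_qroots_exponent(2)[OF that True] by (simp add: power_add)
    qed (use that in \<open>simp add: t_def\<close>)
    have 3: "(of_nat (n + 1 + j) - of_nat (n - j) :: rat fps) = of_nat (2 * j + 1)"
      using that by (simp add: of_nat_diff)
    show ?thesis
      unfolding 1 2 3[symmetric] by (simp add: power_add algebra_simps)
  qed
  have "(-1) ^ n * fps_X ^ ?e * qpoch n ^ 2 = (\<Sum>m\<le>?N. t m)"
    unfolding t_def poly_pderiv_qroots[symmetric]
    by (rule poly_pderiv_sum) (simp add: degree_qroots)
  also have "\<dots> = (\<Sum>m<Suc n + Suc n. t m)"
    by (intro sum.cong) auto
  \<comment> \<open>The 2 n + 2 terms are cut in the middle and the lower half is reversed, so that
    partners get the same summation index.\<close>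
  also have "\<dots> = (\<Sum>m<Suc n. t (n - m)) + (\<Sum>m<Suc n. t (n + 1 + m))"
    unfolding sum_lessThan_add by (subst (2) sum.nat_diff_reindex[symmetric]) simp
  also have "\<dots> = (\<Sum>j\<le>n. t (n + 1 + j) + t (n - j))"
    unfolding sum.distrib lessThan_Suc_atMost by (simp only: add.commute)
  also have "\<dots> = (-1) ^ n * fps_X ^ ?e * (\<Sum>j\<le>n. (-1) ^ j * of_nat (2 * j + 1) * fps_X ^ (Suc j choose 2) * ?c j)"
    unfolding sum_distrib_left by (intro sum.cong refl pair) simp
  finally show ?thesis
    by simp
qed

text \<open>As n grows, \<open>finite_jacobi\<close> tends to E^2 = J / E, since each Gaussian
  coefficient tends to E / (E E) = 1 / E. The bound j \<le> m on the sum loses nothing because a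
  triangular number is at least its index.\<close>

theorem jacobi_euler_cube:
  "euler_prod 1 ^ 3 = Abs_fps (\<lambda>m. \<Sum>j\<le>m. if m = (Suc j choose 2) then (-1) ^ j * of_nat (2 * j + 1) else 0)"
  (is "_ = ?J")
proof -
  let ?E = "euler_prod 1"
  have E0: "fps_nth ?E 0 = 1" by (rule euler_prod_has_prod(2)) simp
  have EE: "?E * inverse ?E = 1"
    by (rule inverse_mult_eq_1') (use E0 in simp)
  define c where "c n j = qpoch (2 * n + 1) * inverse (qpoch (n + 1 + j)) * inverse (qpoch (n - j))" for n j
  define a where "a j = (-1) ^ j * of_nat (2 * j + 1) * (fps_X :: rat fps) ^ (Suc j choose 2)" for j
  define S where "S m = (\<Sum>j\<le>m. a j)" for m
  have choose_ge: "j \<le> Suc j choose 2" for j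
    by (simp add: numeral_2_eq_2)
  have a_nth: "fps_nth (a j) m = (if m = (Suc j choose 2) then (-1) ^ j * of_nat (2 * j + 1) else 0)" for j m
  proof -
    have "a j = fps_const ((-1) ^ j * of_nat (2 * j + 1)) * fps_X ^ (Suc j choose 2)"
      by (simp add: a_def fps_of_nat[symmetric] fps_const_power[symmetric] fps_const_mult[symmetric] fps_const_neg[symmetric] del: fps_const_neg fps_const_mult fps_const_power)
    then show ?thesis by simp
  qed
  have S_nth: "fps_nth (S m) k = fps_nth ?J k" if "k \<le> m" for k m
  proof -
    have "fps_nth (S m) k = (\<Sum>j\<le>m. fps_nth (a j) k)"
      by (simp add: S_def fps_sum_nth)
    also have "\<dots> = (\<Sum>j\<le>k. fps_nth (a j) k)"
      using that choose_ge by (intro sum.mono_neutral_right) (auto simp: a_nth not_le dest: leD)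
    finally show ?thesis by (simp add: a_nth)
  qed
  have sub: "filterlim (\<lambda>n. n - j) at_top at_top" "filterlim (\<lambda>n. n + 1 + j) at_top at_top"
    "filterlim (\<lambda>n::nat. 2 * n + 1) at_top at_top" for j :: nat
    unfolding filterlim_at_top eventually_sequentially
    by (metis le_diff_conv2 add_leE, metis trans_le_add1, metis trans_le_add1 mult_2)
  have c_lim: "(\<lambda>n. c n j) \<longlonglongrightarrow> ?E * inverse ?E * inverse ?E" for j
    unfolding c_def
    by (intro tendsto_mult_fps tendsto_inverse_fps filterlim_compose[OF qpoch_tendsto] sub) (use E0 in simp_all)
  have "?E ^ 2 = ?J * inverse ?E"
  proof (rule fps_ext)
    fix m
    have "(\<lambda>n. \<Sum>j\<le>m. a j * c n j) \<longlonglongrightarrow> (\<Sum>j\<le>m. a j * (?E * inverse ?E * inverse ?E))"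
      by (rule tendsto_sum_fps) (intro tendsto_mult_fps tendsto_const c_lim)
    then have "eventually (\<lambda>n. fps_nth (\<Sum>j\<le>m. a j * c n j) m = fps_nth (S m * inverse ?E) m) sequentially"
      unfolding tendsto_fps_iff S_def sum_distrib_right EE mult_1_left by blast
    moreover have "eventually (\<lambda>n. fps_nth (qpoch n ^ 2) m = fps_nth (?E ^ 2) m) sequentially"
      using tendsto_power_fps[OF qpoch_tendsto] unfolding tendsto_fps_iff by blast
    moreover have "eventually (\<lambda>n. n \<ge> m) sequentially"
      by (rule eventually_ge_at_top)
    ultimately have "eventually (\<lambda>n. fps_nth (?E ^ 2) m = fps_nth (S m * inverse ?E) m) sequentially"
    proof eventually_elim
      case (elim n)
      have "fps_nth (qpoch n ^ 2) m = (\<Sum>j\<le>n. fps_nth (a j * c n j) m)"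
        unfolding finite_jacobi a_def c_def by (simp add: fps_sum_nth)
      also have "\<dots> = (\<Sum>j\<le>m. fps_nth (a j * c n j) m)"
      proof (intro sum.mono_neutral_right ballI)
        fix j assume "j \<in> {..n} - {..m}"
        \<comment> \<open>The summands with j > m start beyond exponent m, so the number of relevant
          summands does not grow with n and the limit may be taken termwise.\<close>
        then have "m < Suc j choose 2" using choose_ge[of j] by auto
        then show "fps_nth (a j * c n j) m = 0"
          by (auto simp: fps_mult_nth a_nth)
      qed (use elim in auto)
      finally show ?case using elim by (simp add: fps_sum_nth)
    qed
    \<comment> \<open>The equation does not mention n, so holding eventually means holding.\<close>
    then have "fps_nth (?E ^ 2) m = fps_nth (S m * inverse ?E) m"
      by simp
    also have "\<dots> = fps_nth (?J * inverse ?E) m"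
      unfolding fps_mult_nth by (intro sum.cong refl) (simp only: S_nth atLeastAtMost_iff)
    finally show "fps_nth (?E ^ 2) m = fps_nth (?J * inverse ?E) m" .
  qed
  then have "?E ^ 2 * ?E = ?J * (?E * inverse ?E)"
    by (simp only: mult_ac)
  then show ?thesis
    by (simp only: EE mult_1_right power3_eq_cube power2_eq_square)
qed

subsection \<open>Trisection of power series\<close>

definition fps_part :: "nat \<Rightarrow> 'a :: idom fps \<Rightarrow> 'a fps" where
  "fps_part r f = Abs_fps (\<lambda>n. fps_nth f (3 * n + r))"

definition dilate :: "'a :: idom fps \<Rightarrow> 'a fps" where
  "dilate f = f oo fps_X ^ 3"

lemma dilate_nth: "fps_nth (dilate f) n = (if 3 dvd n then fps_nth f (n div 3) else 0)"
  by (simp add: dilate_def fps_nth_compose_X_power)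

lemma dilate_1 [simp]: "dilate 1 = 1"
  and dilate_X [simp]: "dilate fps_X = fps_X ^ 3"
  and dilate_add: "dilate (f + g) = dilate f + dilate g"
  and dilate_diff: "dilate (f - g) = dilate f - dilate g"
  and dilate_mult: "dilate (f * g) = dilate f * dilate g"
  and dilate_power: "dilate (f ^ n) = dilate f ^ n"
  and dilate_prod: "dilate (prod h I) = (\<Prod>i\<in>I. dilate (h i))"
  by (simp_all add: dilate_def fps_compose_add_distrib fps_compose_sub_distrib
        fps_compose_mult_distrib fps_compose_power fps_compose_prod_distrib)

lemma dilate_0 [simp]: "dilate 0 = 0"
  using dilate_diff[of 0 0] by simp

lemma dilate_uminus: "dilate (- f) = - dilate f"
  using dilate_diff[of 0 f] by simp

lemma dilate_of_int [simp]: "dilate (of_int c) = of_int c"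
  unfolding fps_of_int[symmetric] by (simp add: dilate_def)

lemma dilate_numeral [simp]: "dilate (numeral c) = numeral c"
  using dilate_of_int[of "numeral c"] by simp

lemmas dilate_simps = dilate_add dilate_diff dilate_mult dilate_power

lemma fps_part_nth [simp]: "fps_nth (fps_part r f) n = fps_nth f (3 * n + r)"
  by (simp add: fps_part_def)

lemma fps_part_add: "fps_part r (f + g) = fps_part r f + fps_part r g"
  by (simp add: fps_eq_iff)

lemma fps_part_X_mult:
  "fps_part 0 (fps_X * f) = fps_X * fps_part 2 f"
  "fps_part 1 (fps_X * f) = fps_part 0 f"
  "fps_part 2 (fps_X * f) = fps_part 1 f"
  by (auto simp: fps_eq_iff numeral_2_eq_2 intro!: arg_cong[of _ _ "fps_nth f"])

text \<open>Series in X^3 move exponents by multiples of 3 and therefore act as scalars on each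
  residue class. With r < 3, the multiples of 3 up to 3 n + r are exactly 3 i for i \<le> n.\<close>

lemma fps_part_dilate_mult:
  assumes "r < 3"
  shows "fps_part r (dilate g * f) = g * fps_part r f"
proof (rule fps_ext)
  fix n
  have "fps_nth (fps_part r (dilate g * f)) n =
      (\<Sum>i\<in>{0..3 * n + r}. fps_nth (dilate g) i * fps_nth f (3 * n + r - i))"
    by (simp add: fps_mult_nth)
  also have "\<dots> = (\<Sum>i\<in>(*) 3 ` {0..n}. fps_nth (dilate g) i * fps_nth f (3 * n + r - i))"
    using assms by (intro sum.mono_neutral_right) (auto simp: dilate_nth elim!: dvdE)
  also have "\<dots> = (\<Sum>i\<in>{0..n}. fps_nth g i * fps_nth f (3 * n + r - 3 * i))"
    by (subst sum.reindex) (auto simp: dilate_nth inj_on_def)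
  also have "\<dots> = fps_nth (g * fps_part r f) n"
    unfolding fps_mult_nth by (intro sum.cong refl) (auto simp: diff_mult_distrib2)
  finally show "fps_nth (fps_part r (dilate g * f)) n = fps_nth (g * fps_part r f) n" .
qed

lemma fps_part_1: "fps_part r 1 = (if r = 0 then 1 else 0)"
  by (auto simp: fps_eq_iff)

lemma fps_part_dilate:
  assumes "r < 3"
  shows "fps_part r (dilate f) = (if r = 0 then f else 0)"
  using fps_part_dilate_mult[OF assms, of f 1] by (simp add: fps_part_1)

lemma fps_trisection:
  "f = dilate (fps_part 0 f) + fps_X * dilate (fps_part 1 f) + fps_X\<^sup>2 * dilate (fps_part 2 f)"
proof (rule fps_ext)
  fix n :: nat
  have "n mod 3 = 0 \<or> n mod 3 = 1 \<or> n mod 3 = 2" by linarith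
  then obtain k r where "n = 3 * k + r" "r = 0 \<or> r = 1 \<or> r = 2"
    by (metis mult_div_mod_eq)
  then show "fps_nth f n = fps_nth (dilate (fps_part 0 f) + fps_X * dilate (fps_part 1 f) + fps_X\<^sup>2 * dilate (fps_part 2 f)) n"
    by (elim disjE; cases k) (auto simp: dilate_nth fps_X_power_mult_nth dvd_def; presburger)+
qed

lemma fps_part_trisection:
  "fps_part 0 (dilate a + fps_X * dilate b + fps_X\<^sup>2 * dilate c) = a"
  "fps_part 1 (dilate a + fps_X * dilate b + fps_X\<^sup>2 * dilate c) = b"
  "fps_part 2 (dilate a + fps_X * dilate b + fps_X\<^sup>2 * dilate c) = c"
  unfolding power2_eq_square mult.assoc
  by (simp_all add: fps_part_add fps_part_X_mult fps_part_X_mult[simplified] fps_part_dilate)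

lemma fps_part_mult:
  "fps_part 0 (f * g) = fps_part 0 f * fps_part 0 g + fps_X * (fps_part 1 f * fps_part 2 g + fps_part 2 f * fps_part 1 g)"
  "fps_part 1 (f * g) = fps_part 0 f * fps_part 1 g + fps_part 1 f * fps_part 0 g + fps_X * (fps_part 2 f * fps_part 2 g)"
  "fps_part 2 (f * g) = fps_part 0 f * fps_part 2 g + fps_part 1 f * fps_part 1 g + fps_part 2 f * fps_part 0 g"
proof -
  let ?a = "fps_part 0 f" and ?b = "fps_part 1 f" and ?c = "fps_part 2 f"
  have "f * g = (dilate ?a + fps_X * dilate ?b + fps_X\<^sup>2 * dilate ?c) * g"
    using fps_trisection[of f] by simp
  also have "\<dots> = dilate ?a * g + dilate ?b * (fps_X * g) + dilate ?c * (fps_X * (fps_X * g))"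
    by (simp add: algebra_simps power2_eq_square)
  finally have fg: "f * g = dilate ?a * g + dilate ?b * (fps_X * g) + dilate ?c * (fps_X * (fps_X * g))" .
  have part: "fps_part r (f * g) = ?a * fps_part r g + ?b * fps_part r (fps_X * g) + ?c * fps_part r (fps_X * (fps_X * g))"
    if "r < 3" for r
    unfolding fg fps_part_add using that by (simp only: fps_part_dilate_mult)
  show "fps_part 0 (f * g) = ?a * fps_part 0 g + fps_X * (?b * fps_part 2 g + ?c * fps_part 1 g)"
    and "fps_part 1 (f * g) = ?a * fps_part 1 g + ?b * fps_part 0 g + fps_X * (?c * fps_part 2 g)"
    and "fps_part 2 (f * g) = ?a * fps_part 2 g + ?b * fps_part 1 g + ?c * fps_part 0 g"
    by (simp_all add: part fps_part_X_mult[simplified] fps_part_X_mult algebra_simps)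
qed

(* With w a primitive cube root of unity, f(X) f(w X) f(w^2 X) is a series in X^3; this is the
   result of writing X for X^3 in it. *)
definition fps_norm :: "'a :: idom fps \<Rightarrow> 'a fps" where
  "fps_norm f = fps_part 0 f ^ 3 + fps_X * fps_part 1 f ^ 3 + fps_X\<^sup>2 * fps_part 2 f ^ 3
     - 3 * fps_X * fps_part 0 f * fps_part 1 f * fps_part 2 f"

text \<open>This is the multiplicativity of the norm form of a + b t + c t^2 with t^3 = x: p, q and
  r are the coordinates of the product of two such elements.\<close>

lemma cubic_norm_mult:
  fixes x :: "'a :: idom"
  assumes "p = a * d + x * (b * f + c * e)"
    and "q = a * e + b * d + x * (c * f)"
    and "r = a * f + b * e + c * d"
  shows "p ^ 3 + x * q ^ 3 + x\<^sup>2 * r ^ 3 - 3 * x * p * q * r =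
    (a ^ 3 + x * b ^ 3 + x\<^sup>2 * c ^ 3 - 3 * x * a * b * c) *
    (d ^ 3 + x * e ^ 3 + x\<^sup>2 * f ^ 3 - 3 * x * d * e * f)"
  unfolding assms by (simp add: algebra_simps power2_eq_square power3_eq_cube)

lemma fps_norm_mult: "fps_norm (f * g) = fps_norm f * fps_norm g"
  unfolding fps_norm_def by (rule cubic_norm_mult fps_part_mult)+

lemma fps_norm_1 [simp]: "fps_norm 1 = 1"
  by (simp add: fps_norm_def fps_part_1)

lemma fps_norm_power: "fps_norm (f ^ n) = fps_norm f ^ n"
  by (induction n) (simp_all add: fps_norm_mult)

text \<open>A series in X^3 is its own conjugate, so its norm is a cube. If 3 does not divide m, the
  conjugates 1 - w^i X^m multiply to 1 - X^(3 m), which becomes 1 - X^m once X is written for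
  X^3.\<close>

lemma fps_norm_one_minus_X_power:
  fixes m :: nat
  defines "X \<equiv> fps_X :: 'a :: idom fps"
  shows "fps_norm (1 - X ^ (3 * m)) = (1 - X ^ m) ^ 3"
    and "fps_norm (1 - X ^ (3 * m + 1)) = 1 - X ^ (3 * m + 1)"
    and "fps_norm (1 - X ^ (3 * m + 2)) = 1 - X ^ (3 * m + 2)"
proof -
  have "fps_norm (dilate a + fps_X * dilate b + fps_X\<^sup>2 * dilate c) =
      a ^ 3 + fps_X * b ^ 3 + fps_X\<^sup>2 * c ^ 3 - 3 * fps_X * a * b * c" for a b c :: "'a fps"
    unfolding fps_norm_def fps_part_trisection ..
  note norm = this
  show "fps_norm (1 - X ^ (3 * m)) = (1 - X ^ m) ^ 3"
    using norm[of "1 - X ^ m" 0 0] by (simp add: X_def dilate_simps power_mult)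
  show "fps_norm (1 - X ^ (3 * m + 1)) = 1 - X ^ (3 * m + 1)"
    using norm[of 1 "- (X ^ m)" 0]
    by (simp add: X_def dilate_simps dilate_uminus mult.commute flip: power_mult)
  show "fps_norm (1 - X ^ (3 * m + 2)) = 1 - X ^ (3 * m + 2)"
    using norm[of 1 0 "- (X ^ m)"]
    by (simp add: X_def dilate_simps dilate_uminus power_add power2_eq_square mult_ac flip: power_mult)
qed

lemma tendsto_fps_part:
  assumes "(f \<longlongrightarrow> a) F"
  shows "((\<lambda>x. fps_part r (f x)) \<longlongrightarrow> fps_part r a) F"
  using assms unfolding tendsto_fps_iff by simp

lemma tendsto_dilate:
  assumes "(f \<longlongrightarrow> a) F"
  shows "((\<lambda>x. dilate (f x)) \<longlongrightarrow> dilate a) F"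
  using assms unfolding tendsto_fps_iff by (simp add: dilate_nth)

lemma tendsto_fps_norm:
  assumes "(f \<longlongrightarrow> a) F"
  shows "((\<lambda>x. fps_norm (f x)) \<longlongrightarrow> fps_norm a) F"
  unfolding fps_norm_def
  by (intro tendsto_add_fps tendsto_diff_fps tendsto_mult_fps tendsto_power_fps tendsto_const
      tendsto_fps_part assms)

lemma dilate_euler_prod_1: "dilate (euler_prod 1) = euler_prod 3"
proof -
  have "(\<lambda>n. dilate (qpoch n)) \<longlonglongrightarrow> dilate (euler_prod 1)"
    by (intro tendsto_dilate qpoch_tendsto)
  moreover have "dilate (qpoch n) = (\<Prod>k<n. 1 - fps_X ^ (3 * Suc k))" for n
    unfolding qpoch_def dilate_prod by (simp only: dilate_diff dilate_power dilate_X dilate_1 power_mult)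
  ultimately show ?thesis
    using euler_prod_tendsto[of 3] LIMSEQ_unique by simp
qed

text \<open>In \<open>qpoch (3 * n)\<close> the norm fixes the factors with exponent prime to 3 and
  sends those with exponent 3 m to (1 - X^m)^3. Multiplying by \<open>dilate (qpoch n)\<close>
  restores the factors with exponent 3 m. The length 3 n makes the factors come in complete
  triples.\<close>

lemma fps_norm_euler_prod: "fps_norm (euler_prod 1) * euler_prod 3 = euler_prod 1 ^ 4"
proof -
  have eq: "fps_norm (qpoch (3 * n)) * dilate (qpoch n) = qpoch (3 * n) * qpoch n ^ 3" for n
  proof (induction n)
    case (Suc n)
    let ?a = "1 - fps_X ^ (3 * n + 1) :: rat fps" and ?b = "1 - fps_X ^ (3 * n + 2) :: rat fps"
    let ?c = "1 - fps_X ^ (3 * Suc n) :: rat fps"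
    have q: "qpoch (3 * Suc n) = qpoch (3 * n) * ?a * ?b * ?c"
      by (simp add: qpoch_Suc numeral_3_eq_3)
    have "fps_norm (qpoch (3 * Suc n)) * dilate (qpoch (Suc n)) =
        (fps_norm (qpoch (3 * n)) * dilate (qpoch n)) * ?a * ?b * (1 - fps_X ^ Suc n) ^ 3 * ?c"
      unfolding q fps_norm_mult fps_norm_one_minus_X_power qpoch_Suc dilate_simps dilate_1 dilate_X
        power_mult[symmetric] by (simp only: mult_ac)
    also have "\<dots> = qpoch (3 * Suc n) * qpoch (Suc n) ^ 3"
      unfolding Suc.IH q qpoch_Suc power_mult_distrib by (simp only: mult_ac)
    finally show ?case .
  qed simp
  have sub: "filterlim (\<lambda>n::nat. 3 * n) at_top at_top"
    by (intro filterlim_subseq) (auto simp: strict_mono_def)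
  have "(\<lambda>n. fps_norm (qpoch (3 * n)) * dilate (qpoch n)) \<longlonglongrightarrow> fps_norm (euler_prod 1) * dilate (euler_prod 1)"
    by (intro tendsto_mult_fps tendsto_fps_norm tendsto_dilate qpoch_tendsto
        filterlim_compose[OF qpoch_tendsto sub])
  moreover have "(\<lambda>n. qpoch (3 * n) * qpoch n ^ 3) \<longlonglongrightarrow> euler_prod 1 * euler_prod 1 ^ 3"
    by (intro tendsto_mult_fps tendsto_power_fps qpoch_tendsto
        filterlim_compose[OF qpoch_tendsto sub])
  ultimately show ?thesis
    unfolding eq dilate_euler_prod_1 by (simp add: LIMSEQ_unique eval_nat_numeral)
qed


section \<open>Trisection of the cube of the Euler product\<close>

lemma two_mult_triangle: "2 * (Suc j choose 2) = j * (j + 1)"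
  by (induction j) (simp_all add: numeral_2_eq_2)

lemma triangle_eq_iff: "(Suc i choose 2) = (Suc j choose 2) \<longleftrightarrow> i = j"
proof -
  have "strict_mono (\<lambda>j. Suc j choose 2)"
    by (simp add: strict_mono_Suc_iff numeral_2_eq_2)
  from strict_mono_eq[OF this] show ?thesis .
qed

lemma euler_cube_nth_triangle:
  "fps_nth (euler_prod 1 ^ 3) (Suc j choose 2) = (-1) ^ j * of_nat (2 * j + 1)"
proof -
  have "j \<le> Suc j choose 2" by (simp add: numeral_2_eq_2)
  then show ?thesis
    unfolding jacobi_euler_cube by (simp add: triangle_eq_iff eq_commute[of "Suc j choose 2"])
qed

lemma euler_cube_nth_nontriangle:
  assumes "\<And>j. m \<noteq> (Suc j choose 2)"
  shows "fps_nth (euler_prod 1 ^ 3) m = 0"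
  unfolding jacobi_euler_cube using assms by simp

text \<open>By Jacobi's identity the exponents of E_1^3 are triangular numbers, so this decides
  which exponents fall into each residue class modulo 3.\<close>

lemma triangle_mod_3:
  "(Suc (3 * m) choose 2) mod 3 = 0"
  "(Suc (3 * m + 1) choose 2) = 9 * (Suc m choose 2) + 1"
  "(Suc (3 * m + 2) choose 2) mod 3 = 0"
proof -
  have 1: "2 * (Suc (3 * m) choose 2) = 3 * (m * (3 * m + 1))"
    unfolding two_mult_triangle by (simp add: algebra_simps)
  show "(Suc (3 * m) choose 2) mod 3 = 0"
    using 1 by presburger
  have 2: "2 * (Suc (3 * m + 1) choose 2) = 9 * (2 * (Suc m choose 2)) + 2"
    unfolding two_mult_triangle by (simp add: algebra_simps)
  then show "(Suc (3 * m + 1) choose 2) = 9 * (Suc m choose 2) + 1"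
    by simp
  have 3: "2 * (Suc (3 * m + 2) choose 2) = 3 * ((3 * m + 2) * (m + 1))"
    unfolding two_mult_triangle by (simp add: algebra_simps)
  show "(Suc (3 * m + 2) choose 2) mod 3 = 0"
    using 3 by presburger
qed

lemma nat_mod_3_cases:
  obtains m where "n = 3 * m" | m where "n = 3 * m + 1" | m where "n = 3 * m + (2 :: nat)"
proof -
  have "n = 3 * (n div 3) \<or> n = 3 * (n div 3) + 1 \<or> n = 3 * (n div 3) + 2"
    by presburger
  then show ?thesis using that by blast
qed

text \<open>The exponents 3 n + 1 are the triangular numbers of index 3 m + 1. Their n is three
  times the triangular number of index m, so Jacobi's series reappears with X^3 for X.\<close>

lemma euler_cube_part_1: "fps_part 1 (euler_prod 1 ^ 3) = - 3 * euler_prod 3 ^ 3"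
proof (rule fps_ext)
  fix n
  have rhs: "fps_nth (- 3 * euler_prod 3 ^ 3) n = - 3 * (if 3 dvd n then fps_nth (euler_prod 1 ^ 3) (n div 3) else 0)"
    unfolding dilate_euler_prod_1[symmetric] dilate_power[symmetric]
    by (simp add: dilate_nth fps_numeral_nth_0 fps_mult_nth_0 numeral_fps_const flip: fps_const_neg)
  show "fps_nth (fps_part 1 (euler_prod 1 ^ 3)) n = fps_nth (- 3 * euler_prod 3 ^ 3) n"
  proof (cases "\<exists>j. 3 * n + 1 = (Suc j choose 2)")
    case True
    then obtain j where j: "3 * n + 1 = (Suc j choose 2)" by blast
    then have "(Suc j choose 2) mod 3 = 1" by presburger
    then obtain m where m: "j = 3 * m + 1"
      using triangle_mod_3(1,3) by (cases rule: nat_mod_3_cases[of j]) auto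
    have n: "n = 3 * (Suc m choose 2)"
      using j unfolding m triangle_mod_3 by simp
    have "fps_nth (fps_part 1 (euler_prod 1 ^ 3)) n = (-1) ^ j * of_nat (2 * j + 1)"
      unfolding fps_part_nth j by (rule euler_cube_nth_triangle)
    \<comment> \<open>For j = 3 m + 1 the weight 2 j + 1 is 3 (2 m + 1) and the sign is opposite to
      that of m.\<close>
    also have "\<dots> = - 3 * ((-1) ^ m * of_nat (2 * m + 1))"
      by (simp add: m power_add power_mult)
    also have "\<dots> = - 3 * fps_nth (euler_prod 1 ^ 3) (n div 3)"
      unfolding n euler_cube_nth_triangle[symmetric] by simp
    also have "\<dots> = fps_nth (- 3 * euler_prod 3 ^ 3) n"
      unfolding rhs by (simp add: n)
    finally show ?thesis .
  next
    case False
    have "fps_nth (euler_prod 1 ^ 3) (n div 3) = 0" if "3 dvd n"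
    proof (rule euler_cube_nth_nontriangle)
      fix j
      have "3 * n + 1 = 9 * (n div 3) + 1" using that by auto
      then show "n div 3 \<noteq> (Suc j choose 2)"
        using False triangle_mod_3(2)[of j] by metis
    qed
    moreover have "fps_nth (euler_prod 1 ^ 3) (3 * n + 1) = 0"
      using False by (intro euler_cube_nth_nontriangle) blast
    ultimately show ?thesis
      unfolding rhs fps_part_nth by (simp only: if_cancel mult_zero_right split: if_split) simp
  qed
qed

lemma euler_cube_part_2: "fps_part 2 (euler_prod 1 ^ 3) = 0"
proof (rule fps_ext)
  fix n
  have "fps_nth (euler_prod 1 ^ 3) (3 * n + 2) = 0"
  proof (rule euler_cube_nth_nontriangle)
    fix j
    have "(Suc j choose 2) mod 3 \<noteq> 2"
      using triangle_mod_3 by (cases rule: nat_mod_3_cases[of j]) (simp_all add: mod_Suc)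
    moreover have "(3 * n + 2) mod 3 = 2" by presburger
    ultimately show "3 * n + 2 \<noteq> (Suc j choose 2)" by metis
  qed
  then show "fps_nth (fps_part 2 (euler_prod 1 ^ 3)) n = fps_nth 0 n"
    by simp
qed

subsection \<open>The cubic equation\<close>

lemma euler_prod_mult_inverse: "j > 0 \<Longrightarrow> euler_prod j * inverse (euler_prod j) = 1"
  using euler_prod_has_prod(2) by (intro inverse_mult_eq_1') simp

lemma euler_prod_nonzero: "j > 0 \<Longrightarrow> euler_prod j \<noteq> 0"
  using euler_prod_has_prod(2)[of j] by auto

lemma fps_part_0: "fps_part r 0 = 0"
  by (simp add: fps_eq_iff)

text \<open>The residue class 2 is empty, so the norm of E_1^3 reduces to p^3 + X (-3 E_3^3)^3. It
  is also the cube of the norm of E_1, which \<open>fps_norm_euler_prod\<close> evaluates.\<close>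

lemma euler_cube_dissection:
  obtains p where "euler_prod 1 ^ 3 = dilate p - 3 * fps_X * dilate (euler_prod 3 ^ 3)"
    and "(p ^ 3 - 27 * fps_X * euler_prod 3 ^ 9) * euler_prod 3 ^ 3 = euler_prod 1 ^ 12"
proof
  let ?p = "fps_part 0 (euler_prod 1 ^ 3)"
  show "euler_prod 1 ^ 3 = dilate ?p - 3 * fps_X * dilate (euler_prod 3 ^ 3)"
    using fps_trisection[of "euler_prod 1 ^ 3"]
    unfolding euler_cube_part_1 euler_cube_part_2 by (simp add: dilate_mult dilate_uminus mult.assoc mult.left_commute)
  have "?p ^ 3 - 27 * fps_X * euler_prod 3 ^ 9 = fps_norm (euler_prod 1) ^ 3"
    unfolding fps_norm_power[symmetric] unfolding fps_norm_def euler_cube_part_1 euler_cube_part_2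
    by (simp add: power_mult_distrib flip: power_mult)
  then have "(?p ^ 3 - 27 * fps_X * euler_prod 3 ^ 9) * euler_prod 3 ^ 3 = (fps_norm (euler_prod 1) * euler_prod 3) ^ 3"
    by (simp add: power_mult_distrib)
  also have "\<dots> = euler_prod 1 ^ 12"
    unfolding fps_norm_euler_prod by (simp flip: power_mult)
  finally show "(?p ^ 3 - 27 * fps_X * euler_prod 3 ^ 9) * euler_prod 3 ^ 3 = euler_prod 1 ^ 12" .
qed

text \<open>E_9 is written as \<open>dilate (euler_prod 3)\<close>, which lets it leave
  \<open>fps_part\<close> as a scalar.\<close>

definition eta_xi :: "rat fps" where
  "eta_xi = fps_X * dilate (euler_prod 3 ^ 3) * inverse (euler_prod 1) ^ 3"

definition eta_y :: "rat fps" where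
  "eta_y = fps_X * euler_prod 3 ^ 12 * inverse (euler_prod 1) ^ 12"

text \<open>With B = E_1^3 and g = E_9^3, xi = X g / B, and y = X E_3^9 / D where D is the norm of
  B. The two parts are the initial values for the recurrence that the cubic gives.\<close>

lemma eta_xi_relations:
  "eta_xi ^ 3 = dilate eta_y * (27 * eta_xi\<^sup>2 + 9 * eta_xi + 1)" (is ?cubic)
  "fps_part 0 eta_xi = 9 * eta_y" (is ?part1)
  "fps_part 0 (eta_xi\<^sup>2) = 6 * eta_y + 243 * eta_y\<^sup>2" (is ?part2)
proof -
  let ?E = "euler_prod 1" and ?F = "euler_prod 3"
  obtain p where E: "?E ^ 3 = dilate p - 3 * fps_X * dilate (?F ^ 3)"
    and p: "(p ^ 3 - 27 * fps_X * ?F ^ 9) * ?F ^ 3 = ?E ^ 12"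
    by (rule euler_cube_dissection)
  define G P g D B where "G = ?F ^ 3" and "P = dilate p" and "g = dilate G"
    and "D = p ^ 3 - 27 * fps_X * G ^ 3" and "B = ?E ^ 3"
  have B: "B = P - 3 * fps_X * g" using E by (simp add: B_def P_def g_def G_def)
  have D: "D * G = ?E ^ 12" using p by (simp add: D_def G_def flip: power_mult)
  have dD: "dilate D = P ^ 3 - 27 * fps_X ^ 3 * g ^ 3"
    by (simp add: D_def P_def g_def dilate_simps)
  have invE: "?E * inverse ?E = 1" by (rule euler_prod_mult_inverse) simp
  have [simp]: "?E \<noteq> 0" "?F \<noteq> 0" by (simp_all only: euler_prod_nonzero zero_less_one zero_less_numeral not_False_eq_True)
  have B0: "B \<noteq> 0" unfolding B_def by (simp del: One_nat_def)
  have D0: "D \<noteq> 0" using D by (auto simp del: One_nat_def)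
  have dD0: "dilate D \<noteq> 0"
    using D0 fps_part_dilate[of 0 D] by (auto simp: fps_part_0)
  have xi: "eta_xi * B = fps_X * g"
    using power_mult_distrib[of ?E "inverse ?E" 3]
    by (simp add: eta_xi_def B_def g_def G_def invE mult_ac del: One_nat_def)
  have y: "eta_y * D = fps_X * G ^ 3"
  proof -
    have "eta_y * (D * G) = fps_X * ?F ^ 12 * (?E * inverse ?E) ^ 12"
      unfolding D eta_y_def power_mult_distrib by (simp only: mult_ac)
    then have "eta_y * D * G = fps_X * G ^ 3 * G"
      unfolding invE by (simp add: G_def mult_ac flip: power_mult power_add power_Suc)
    then show ?thesis by (simp add: G_def)
  qed
  have dy: "dilate eta_y * dilate D = fps_X ^ 3 * g ^ 3"
    using arg_cong[OF y, of dilate] by (simp add: dilate_simps g_def)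
  note ring = algebra_simps power2_eq_square power3_eq_cube
  \<comment> \<open>P = B + 3 X g is substituted into P^3 - (3 X g)^3.\<close>
  have cubic: "dilate D = 27 * (fps_X * g)\<^sup>2 * B + 9 * (fps_X * g) * B\<^sup>2 + B ^ 3"
    unfolding dD B by (simp add: ring)
  \<comment> \<open>A difference of cubes: the cofactor of B rationalizes the denominator of xi,
    replacing B by the series \<open>dilate D\<close> in X^3.\<close>
  have factor: "dilate D = B * (P\<^sup>2 + 3 * fps_X * P * g + 9 * fps_X\<^sup>2 * g\<^sup>2)"
    unfolding dD B by (simp add: ring)
  have "eta_xi ^ 3 * (B ^ 3 * dilate D) = (eta_xi * B) ^ 3 * dilate D"
    by (simp add: power_mult_distrib mult_ac)
  also have "\<dots> = fps_X ^ 3 * g ^ 3 * (27 * (eta_xi * B)\<^sup>2 * B + 9 * (eta_xi * B) * B\<^sup>2 + B ^ 3)"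
    unfolding xi cubic by (simp only: power_mult_distrib)
  also have "\<dots> = dilate eta_y * (27 * eta_xi\<^sup>2 + 9 * eta_xi + 1) * (B ^ 3 * dilate D)"
    unfolding dy[symmetric] by (simp add: ring)
  finally show ?cubic using B0 dD0 by simp
  have "dilate D * eta_xi * B = dilate D * (eta_xi * B)"
    by (simp only: mult_ac)
  also have "\<dots> = fps_X * g * (P\<^sup>2 + 3 * fps_X * P * g + 9 * fps_X\<^sup>2 * g\<^sup>2) * B"
    unfolding xi factor by (simp only: mult_ac)
  finally have xi': "dilate D * eta_xi = fps_X * g * (P\<^sup>2 + 3 * fps_X * P * g + 9 * fps_X\<^sup>2 * g\<^sup>2)"
    using B0 by simp
  \<comment> \<open>The terms are sorted by exponent modulo 3, with P and g being series in
    X^3.\<close>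
  also have "\<dots> = dilate (9 * fps_X * G ^ 3) + fps_X * dilate (G * p\<^sup>2) + fps_X\<^sup>2 * dilate (3 * G\<^sup>2 * p)"
    unfolding P_def g_def by (simp add: dilate_simps ring)
  finally have "fps_part 0 (dilate D * eta_xi) = 9 * fps_X * G ^ 3"
    by (simp only: fps_part_trisection)
  then have "D * fps_part 0 eta_xi = D * (9 * eta_y)"
    using y unfolding fps_part_dilate_mult[OF zero_less_numeral] by (simp add: mult_ac)
  then show ?part1 using D0 by simp
  have "dilate (D\<^sup>2) * eta_xi\<^sup>2 = (dilate D * eta_xi)\<^sup>2"
    by (simp add: dilate_simps power_mult_distrib)
  also have "\<dots> = dilate (6 * fps_X * G ^ 3 * p ^ 3 + 81 * fps_X\<^sup>2 * (G ^ 3)\<^sup>2)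
      + fps_X * dilate (27 * fps_X * (G\<^sup>2)\<^sup>2 * p\<^sup>2) + fps_X\<^sup>2 * dilate (G\<^sup>2 * (p\<^sup>2)\<^sup>2 + 54 * fps_X * p * (G\<^sup>2 * G ^ 3))"
    unfolding xi' P_def g_def by (simp add: dilate_simps ring)
  finally have "fps_part 0 (dilate (D\<^sup>2) * eta_xi\<^sup>2) = 6 * fps_X * G ^ 3 * p ^ 3 + 81 * fps_X\<^sup>2 * (G ^ 3)\<^sup>2"
    by (simp only: fps_part_trisection)
  then have "D\<^sup>2 * fps_part 0 (eta_xi\<^sup>2) = 6 * fps_X * G ^ 3 * p ^ 3 + 81 * fps_X\<^sup>2 * (G ^ 3)\<^sup>2"
    by (simp add: fps_part_dilate_mult)
  \<comment> \<open>Here p^3 = D + 27 X G^3, and 243 = 81 + 6 * 27.\<close>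
  also have "\<dots> = 6 * (fps_X * G ^ 3) * D + 243 * (fps_X * G ^ 3)\<^sup>2"
    unfolding D_def by (simp add: ring)
  also have "\<dots> = D\<^sup>2 * (6 * eta_y + 243 * eta_y\<^sup>2)"
    unfolding y[symmetric] by (simp add: ring)
  finally show ?part2 using D0 by simp
qed

section \<open>The matrix m as coefficients of the trisected powers of xi\<close>

lemma fps_part_numeral_mult: "fps_part r (numeral c * f) = numeral c * fps_part r f"
  by (simp add: fps_eq_iff numeral_fps_const)

lemma fps_part_of_int_mult: "fps_part r (of_int c * f) = of_int c * fps_part r f"
  by (simp add: fps_eq_iff flip: fps_of_int)

lemma fps_part_sum: "fps_part r (\<Sum>i\<in>I. f i) = (\<Sum>i\<in>I. fps_part r (f i))"
  by (simp add: fps_eq_iff fps_sum_nth)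

lemma m_mat_0 [simp]: "m_mat 0 j = 0"
  by (induction "0 :: nat" j rule: m_mat.induct) auto

lemma m_mat_1: "m_mat (Suc 0) k = (if k = 1 then 9 else 0)"
  by (induction "Suc 0" k rule: m_mat.induct) auto

lemma m_mat_2: "m_mat 2 k = (if k = 1 then 6 else if k = 2 then 243 else 0)"
  by (cases "(2 :: nat, k)" rule: m_mat.cases) (auto simp: m_mat_1)

text \<open>The recurrence is extended to the first column. The last summand makes up for xi^0 = 1,
  which would require m(0,0) = 1 while row 0 of \<open>m_mat\<close> is zero.\<close>

lemma m_mat_rec:
  assumes "i \<ge> 3"
  shows "m_mat i (Suc k) = 27 * m_mat (i - 1) k + 9 * m_mat (i - 2) k + m_mat (i - 3) k
    + (if i = 3 \<and> k = 0 then 1 else 0)"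
  using assms by (cases k) auto

text \<open>Multiplying the cubic by xi^(i-3) and taking part 0, where \<open>dilate eta_y\<close>
  comes out as \<open>eta_y\<close>, gives the recurrence of \<open>m_mat\<close>. Any K \<ge> i
  will do, which lets the induction use a common bound for the three smaller powers.\<close>

lemma part_eta_xi_power:
  assumes "i \<ge> 1" "i \<le> K"
  shows "fps_part 0 (eta_xi ^ i) = (\<Sum>k\<le>K. of_int (m_mat i k) * eta_y ^ k)"
  using assms
proof (induction i arbitrary: K rule: less_induct)
  case (less i)
  consider "i = 1" | "i = 2" | "i \<ge> 3" using less.prems by linarith
  then show ?case
  proof cases
    case 1
    have "(\<Sum>k\<le>K. of_int (m_mat i k) * eta_y ^ k) = (\<Sum>k\<in>{1}. of_int (m_mat i k) * eta_y ^ k)"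
      using 1 less.prems by (intro sum.mono_neutral_right) (auto simp: m_mat_1)
    then show ?thesis using 1 eta_xi_relations(2)
      by (simp add: m_mat_1)
  next
    case 2
    have "(\<Sum>k\<le>K. of_int (m_mat i k) * eta_y ^ k) = (\<Sum>k\<in>{1, 2}. of_int (m_mat i k) * eta_y ^ k)"
      using 2 less.prems by (intro sum.mono_neutral_right) (auto simp: m_mat_2)
    then show ?thesis using 2 eta_xi_relations(3)
      by (simp add: m_mat_2)
  next
    case 3
    then obtain K' where K: "K = Suc K'" using less.prems by (cases K) auto
    have split: "eta_xi ^ i = dilate eta_y * (27 * eta_xi ^ (i - 1) + 9 * eta_xi ^ (i - 2) + eta_xi ^ (i - 3))"
    proof -
      obtain d where d: "i = d + 3" using 3 by (metis le_add_diff_inverse2)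
      have "eta_xi ^ i = eta_xi ^ d * eta_xi ^ 3" by (simp add: d power_add)
      also have "\<dots> = dilate eta_y * (27 * (eta_xi ^ d * eta_xi\<^sup>2) + 9 * (eta_xi ^ d * eta_xi) + eta_xi ^ d)"
        unfolding eta_xi_relations(1) by (simp add: algebra_simps)
      finally show ?thesis by (simp add: d power_add power2_eq_square eval_nat_numeral)
    qed
    let ?S = "\<lambda>i. \<Sum>k\<le>K'. of_int (m_mat i k) * eta_y ^ k"
    have last: "fps_part 0 (eta_xi ^ (i - 3)) = ?S (i - 3) + (if i = 3 then 1 else 0)"
    proof (cases "i = 3")
      case False
      then show ?thesis using less.IH[of "i - 3" K'] less.prems 3 K by simp
    qed (simp add: fps_part_1)
    have "fps_part 0 (eta_xi ^ i) = eta_y * (27 * ?S (i - 1) + 9 * ?S (i - 2) + ?S (i - 3) + (if i = 3 then 1 else 0))"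
      unfolding split using less.IH[of "i - 1" K'] less.IH[of "i - 2" K'] less.prems 3 K
      by (simp add: fps_part_dilate_mult fps_part_add fps_part_numeral_mult last)
    also have "\<dots> = (\<Sum>k\<le>K'. of_int (m_mat i (Suc k)) * eta_y ^ Suc k)"
    proof -
      have "of_int (m_mat i (Suc k)) * eta_y ^ Suc k =
          eta_y * (27 * (of_int (m_mat (i - 1) k) * eta_y ^ k) + 9 * (of_int (m_mat (i - 2) k) * eta_y ^ k)
            + of_int (m_mat (i - 3) k) * eta_y ^ k + (if k = 0 then if i = 3 then 1 else 0 else 0))" for k
        unfolding m_mat_rec[OF 3] by (simp add: algebra_simps)
      then have "(\<Sum>k\<le>K'. of_int (m_mat i (Suc k)) * eta_y ^ Suc k) = (\<Sum>k\<le>K'.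
          eta_y * (27 * (of_int (m_mat (i - 1) k) * eta_y ^ k) + 9 * (of_int (m_mat (i - 2) k) * eta_y ^ k)
            + of_int (m_mat (i - 3) k) * eta_y ^ k + (if k = 0 then if i = 3 then 1 else 0 else 0)))"
        by (simp only:)
      then show ?thesis
        by (simp add: sum.distrib flip: sum_distrib_left)
    qed
    also have "\<dots> = (\<Sum>k\<le>K. of_int (m_mat i k) * eta_y ^ k)"
      unfolding K sum.atMost_Suc_shift by simp
    finally show ?thesis .
  qed
qed

subsection \<open>Extraction of residue classes\<close>

text \<open>The index l starts at 0 and stands for l + 1 in the theorem.\<close>

definition odd_term :: "nat \<Rightarrow> rat fps" where
  "odd_term l = fps_X ^ l * (euler_prod 3 ^ (12 * Suc l - 6) / euler_prod 1 ^ (12 * Suc l))"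

definition even_term :: "nat \<Rightarrow> rat fps" where
  "even_term l = fps_X ^ l * (euler_prod 3 ^ (12 * Suc l) / euler_prod 1 ^ (12 * Suc l + 6))"

lemma divide_euler_power: "f / euler_prod 1 ^ n = f * inverse (euler_prod 1) ^ n"
  using euler_prod_has_prod(2)[of 1]
  by (simp add: fps_divide_unit fps_inverse_power)

lemma euler_power_cancel:
  "euler_prod 1 ^ m * inverse (euler_prod 1) ^ (m + n) = inverse (euler_prod 1) ^ n"
  using euler_prod_mult_inverse[of 1]
  by (simp add: power_add flip: mult.assoc power_mult_distrib)

lemma eta_xi_power: "eta_xi ^ i = fps_X ^ i * dilate (euler_prod 3 ^ (3 * i)) * inverse (euler_prod 1) ^ (3 * i)"
  by (simp add: eta_xi_def power_mult_distrib dilate_power power_mult)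

lemma eta_y_power: "eta_y ^ k = fps_X ^ k * euler_prod 3 ^ (12 * k) * inverse (euler_prod 1) ^ (12 * k)"
  by (simp add: eta_y_def power_mult_distrib power_mult)

text \<open>By \<open>m_mat_support\<close> the columns up to L vanish in row i, so a factor y^(L+1)
  can be split off. This is applied to the rows 4 L and 4 L + 2.\<close>

lemma part_eta_xi_power_tail:
  assumes "i \<ge> 1" "(i + 2) div 3 > L" "i \<le> L + K"
  shows "fps_part 0 (eta_xi ^ i) = (\<Sum>k<K. of_int (m_mat i (L + Suc k)) * eta_y ^ (Suc L + k))"
proof -
  have "fps_part 0 (eta_xi ^ i) = (\<Sum>k<Suc L + K. of_int (m_mat i k) * eta_y ^ k)"
    using part_eta_xi_power[of i "L + K"] assms by (simp add: lessThan_Suc_atMost)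
  also have "\<dots> = (\<Sum>k<K. of_int (m_mat i (Suc L + k)) * eta_y ^ (Suc L + k))"
  proof -
    have "m_mat i k = 0" if "k < Suc L" for k
      using m_mat_support[of i k] assms that by force
    then show ?thesis unfolding sum_lessThan_add by simp
  qed
  finally show ?thesis by simp
qed

text \<open>A factor X moves residue 2 to residue 0. With L = l + 1, the further factor X^(3 L)
  E_9^(12 L) turns the term into E_3^(12 L - 6) xi^(4 L), whose part 0 is known.\<close>

lemma part_odd_term:
  assumes "3 * Suc l \<le> K"
  shows "fps_part 2 (odd_term l) = (\<Sum>k<K. of_int (m_mat (4 * Suc l) (Suc l + Suc k)) * even_term k)"
proof -
  let ?E = "euler_prod 1" and ?F = "euler_prod 3" and ?L = "Suc l"
  let ?g = "fps_X ^ ?L * ?F ^ (12 * ?L)" and ?c = "fps_X ^ Suc ?L * ?F ^ (12 * ?L)"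
  have "dilate ?g * (fps_X * odd_term l) = dilate (?E ^ (12 * ?L - 6)) * eta_xi ^ (4 * ?L)"
  proof -
    have "dilate ?g * (fps_X * odd_term l) =
       (fps_X ^ (3 * ?L) * fps_X * fps_X ^ l) * dilate ?F ^ (12 * ?L) * (?F ^ (12 * ?L - 6) * inverse ?E ^ (12 * ?L))"
      unfolding odd_term_def divide_euler_power dilate_simps dilate_X power_mult[symmetric] by (simp only: mult_ac)
    also have "fps_X ^ (3 * ?L) * fps_X * fps_X ^ l = (fps_X ^ (4 * ?L) :: rat fps)"
      by (simp flip: power_add power_Suc power_Suc2)
    finally show ?thesis
      unfolding eta_xi_power dilate_power dilate_euler_prod_1 by (simp add: mult_ac)
  qed
  then have "fps_part 0 (dilate ?g * (fps_X * odd_term l)) = fps_part 0 (dilate (?E ^ (12 * ?L - 6)) * eta_xi ^ (4 * ?L))"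
    by simp
  then have "?g * (fps_X * fps_part 2 (odd_term l)) = ?E ^ (12 * ?L - 6) * fps_part 0 (eta_xi ^ (4 * ?L))"
    by (simp only: fps_part_dilate_mult zero_less_numeral fps_part_X_mult)
  then have "?c * fps_part 2 (odd_term l) = ?E ^ (12 * ?L - 6) * fps_part 0 (eta_xi ^ (4 * ?L))"
    unfolding power_Suc by (simp only: mult_ac)
  also have "\<dots> = (\<Sum>k<K. of_int (m_mat (4 * ?L) (?L + Suc k)) * (?E ^ (12 * ?L - 6) * eta_y ^ (Suc ?L + k)))"
    using assms by (subst part_eta_xi_power_tail[of _ ?L K]) (auto simp: sum_distrib_left mult_ac)
  also have "\<dots> = (\<Sum>k<K. of_int (m_mat (4 * ?L) (?L + Suc k)) * (?c * even_term k))"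
  proof -
    have "?E ^ (12 * ?L - 6) * eta_y ^ (Suc ?L + k) = ?c * even_term k" for k
    proof -
      \<comment> \<open>The first splitting serves to cancel powers of E_1, the second to separate
        ?c from the powers of E_3.\<close>
      have e: "12 * (Suc ?L + k) = (12 * ?L - 6) + (12 * Suc k + 6)" "12 * (Suc ?L + k) = 12 * ?L + 12 * Suc k"
        by simp_all
      have cancel: "?E ^ (12 * ?L - 6) * inverse ?E ^ (12 * (Suc ?L + k)) = inverse ?E ^ (12 * Suc k + 6)"
        unfolding e(1) by (rule euler_power_cancel)
      have "?E ^ (12 * ?L - 6) * eta_y ^ (Suc ?L + k) =
          fps_X ^ (Suc ?L + k) * ?F ^ (12 * (Suc ?L + k)) * (?E ^ (12 * ?L - 6) * inverse ?E ^ (12 * (Suc ?L + k)))"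
        unfolding eta_y_power by (simp only: mult_ac)
      then show ?thesis
        unfolding cancel unfolding e(2) power_add[of fps_X] power_add[of ?F] even_term_def divide_euler_power
        by (simp only: mult_ac)
    qed
    then show ?thesis by (simp only:)
  qed
  also have "\<dots> = ?c * (\<Sum>k<K. of_int (m_mat (4 * ?L) (?L + Suc k)) * even_term k)"
    by (simp add: sum_distrib_left mult_ac)
  finally show ?thesis
    using euler_prod_nonzero[of 3] by simp
qed

text \<open>Here residue 0 is wanted, so no shift occurs: with L = l + 1, multiplying by X^(3 L + 3)
  E_9^(12 L + 6) gives E_3^(12 L) xi^(4 L + 2).\<close>

lemma part_even_term:
  assumes "3 * Suc l + 2 \<le> K"
  shows "fps_part 0 (even_term l) = (\<Sum>k<K. of_int (m_mat (4 * Suc l + 2) (Suc l + Suc k)) * odd_term k)"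
proof -
  let ?E = "euler_prod 1" and ?F = "euler_prod 3" and ?L = "Suc l"
  let ?c = "fps_X ^ Suc ?L * ?F ^ (12 * ?L + 6)"
  have "dilate ?c * even_term l = dilate (?E ^ (12 * ?L)) * eta_xi ^ (4 * ?L + 2)"
  proof -
    have "dilate ?c * even_term l =
       (fps_X ^ (3 * Suc ?L) * fps_X ^ l) * dilate ?F ^ (12 * ?L + 6) * (?F ^ (12 * ?L) * inverse ?E ^ (12 * ?L + 6))"
      unfolding even_term_def divide_euler_power dilate_simps dilate_X power_mult[symmetric] by (simp only: mult_ac)
    also have "fps_X ^ (3 * Suc ?L) * fps_X ^ l = (fps_X ^ (4 * ?L + 2) :: rat fps)"
      unfolding power_add[symmetric] by (rule arg_cong[of _ _ "power _"]) simp
    finally have 1: "dilate ?c * even_term l =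
       fps_X ^ (4 * ?L + 2) * dilate ?F ^ (12 * ?L + 6) * (?F ^ (12 * ?L) * inverse ?E ^ (12 * ?L + 6))" .
    have 2: "3 * (4 * ?L + 2) = 12 * ?L + 6" by simp
    show ?thesis
      unfolding 1 eta_xi_power dilate_power dilate_euler_prod_1 2 by (simp only: mult_ac)
  qed
  then have "fps_part 0 (dilate ?c * even_term l) = fps_part 0 (dilate (?E ^ (12 * ?L)) * eta_xi ^ (4 * ?L + 2))"
    by simp
  then have "?c * fps_part 0 (even_term l) = ?E ^ (12 * ?L) * fps_part 0 (eta_xi ^ (4 * ?L + 2))"
    by (simp only: fps_part_dilate_mult zero_less_numeral)
  also have "\<dots> = (\<Sum>k<K. of_int (m_mat (4 * ?L + 2) (?L + Suc k)) * (?E ^ (12 * ?L) * eta_y ^ (Suc ?L + k)))"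
    using assms by (subst part_eta_xi_power_tail[of _ ?L K]) (auto simp: sum_distrib_left mult_ac)
  also have "\<dots> = (\<Sum>k<K. of_int (m_mat (4 * ?L + 2) (?L + Suc k)) * (?c * odd_term k))"
  proof -
    have "?E ^ (12 * ?L) * eta_y ^ (Suc ?L + k) = ?c * odd_term k" for k
    proof -
      have e: "12 * (Suc ?L + k) = 12 * ?L + 12 * Suc k" "12 * (Suc ?L + k) = 12 * ?L + 6 + (12 * Suc k - 6)"
        by simp_all
      have cancel: "?E ^ (12 * ?L) * inverse ?E ^ (12 * (Suc ?L + k)) = inverse ?E ^ (12 * Suc k)"
        unfolding e(1) by (rule euler_power_cancel)
      have "?E ^ (12 * ?L) * eta_y ^ (Suc ?L + k) =
          fps_X ^ (Suc ?L + k) * ?F ^ (12 * (Suc ?L + k)) * (?E ^ (12 * ?L) * inverse ?E ^ (12 * (Suc ?L + k)))"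
        unfolding eta_y_power by (simp only: mult_ac)
      then show ?thesis
        unfolding cancel unfolding e(2) power_add[of fps_X] power_add[of ?F] odd_term_def divide_euler_power
        by (simp only: mult_ac)
    qed
    then show ?thesis by (simp only:)
  qed
  also have "\<dots> = ?c * (\<Sum>k<K. of_int (m_mat (4 * ?L + 2) (?L + Suc k)) * odd_term k)"
    by (simp add: sum_distrib_left mult_ac)
  finally show ?thesis
    using euler_prod_nonzero[of 3] by simp
qed

text \<open>X^2 E_9^6 / E_1^6 is xi^2, so the first row of a consists of the coefficients of part 0
  of xi^2.\<close>

lemma part_generating_function:
  "fps_part 1 (1 / euler_prod 1 ^ 6) = 6 * odd_term 0 + 243 * odd_term 1"
proof -
  let ?E = "euler_prod 1" and ?F = "euler_prod 3"
  let ?f = "1 / ?E ^ 6"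
  have f: "?f = inverse ?E ^ 6" unfolding divide_euler_power by simp
  have "dilate (?F ^ 6) * (fps_X * (fps_X * ?f)) = eta_xi\<^sup>2"
    unfolding f eta_xi_power by (simp add: power2_eq_square mult_ac)
  then have "fps_part 0 (dilate (?F ^ 6) * (fps_X * (fps_X * ?f))) = fps_part 0 (eta_xi\<^sup>2)"
    by simp
  then have "?F ^ 6 * (fps_X * fps_part 1 ?f) = 6 * eta_y + 243 * eta_y\<^sup>2"
    unfolding eta_xi_relations(3) by (simp only: fps_part_dilate_mult fps_part_X_mult zero_less_numeral)
  then have "fps_X * ?F ^ 6 * fps_part 1 ?f = 6 * eta_y + 243 * eta_y\<^sup>2"
    by (simp only: mult_ac)
  also have "\<dots> = fps_X * ?F ^ 6 * (6 * odd_term 0 + 243 * odd_term 1)"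
    using eta_y_power[of 2] unfolding odd_term_def divide_euler_power
    by (simp add: eta_y_def power2_eq_square distrib_left mult_ac flip: power_add)
  finally show ?thesis
    using euler_prod_nonzero[of 3] by simp
qed

section \<open>Finite rows of the matrix a and iterated trisection\<close>

text \<open>A nonzero m(4 i + 2, i + k) or m(4 i, i + k) forces k \<le> 3 i + 2, and 3 N + 2 \<le> 4
  N for N \<ge> 2. This crude bound makes all sums finite.\<close>

lemma a_mat_support:
  assumes "a_mat j k \<noteq> 0"
  shows "k \<le> 4 ^ j"
  using assms
proof (induction j k rule: a_mat.induct)
  case (3 j k)
  have "\<exists>i. a_mat (Suc j) (Suc i) \<noteq> 0 \<and> Suc i + k \<le> 4 * Suc i + 2"
  proof (rule ccontr)
    assume no: "\<not> ?thesis"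
    have "a_mat (Suc j) (Suc i) * m_mat (4 * Suc i) (Suc i + k) = 0"
      and "a_mat (Suc j) (Suc i) * m_mat (4 * Suc i + 2) (Suc i + k) = 0" for i
      using no m_mat_support[of "4 * Suc i" "Suc i + k"] m_mat_support[of "4 * Suc i + 2" "Suc i + k"]
      by fastforce+
    then have "a_mat (Suc (Suc j)) k = 0" by (simp only: a_mat.simps suminf_zero if_cancel)
    with 3 show False by blast
  qed
  then obtain i where i: "a_mat (Suc j) (Suc i) \<noteq> 0" "k \<le> 3 * Suc i + 2" by auto
  then have "Suc i \<le> 4 ^ Suc j" using 3 by (cases "odd (Suc j)") blast+
  moreover have "(2 :: nat) \<le> 4 ^ Suc j"
    by (rule order_trans[OF _ self_le_power]) simp_all
  moreover have "k \<le> 4 * N" if "m \<le> N" "2 \<le> N" "k \<le> 3 * m + 2" for m N :: nat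
    using that by linarith
  ultimately show ?case using i(2) unfolding power_Suc[of _ "Suc j"] by blast
qed (auto split: if_splits)

lemma a_mat_Suc:
  assumes "j \<ge> 1"
  shows "a_mat (Suc j) k = (\<Sum>i<4 ^ j. a_mat j (Suc i) *
    m_mat (if odd j then 4 * Suc i else 4 * Suc i + 2) (Suc i + k))"
proof -
  obtain j' where j: "j = Suc j'" using assms by (cases j) auto
  have "a_mat (Suc j) k = (\<Sum>i. a_mat j (Suc i) * m_mat (if odd j then 4 * Suc i else 4 * Suc i + 2) (Suc i + k))"
    unfolding j by (cases "odd (Suc j')") (simp_all only: a_mat.simps if_True if_False simp_thms)
  also have "\<dots> = (\<Sum>i<4 ^ j. a_mat j (Suc i) * m_mat (if odd j then 4 * Suc i else 4 * Suc i + 2) (Suc i + k))"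
    using a_mat_support[of j] by (intro suminf_finite) force+
  finally show ?thesis .
qed

text \<open>Both offsets of the theorem in one sequence, so that a single induction covers odd and
  even steps.\<close>

definition offset :: "nat \<Rightarrow> nat" where
  "offset j = (3 ^ (if odd j then j else j + 1) + 1) div 4"

text \<open>For odd j, 3^(j+2) + 1 = 8 * 3^j + (3^j + 1); for even j both offsets use the exponent j
  + 1. Hence the next residue class modulo 3 is 2 or 0, respectively.\<close>

lemma offset_Suc:
  "offset (Suc j) = (if odd j then 3 ^ j * 2 + offset j else offset j)"
proof (cases "odd j")
  case True
  have "4 dvd (3 :: nat) ^ (2 * i + 1) + 1" for i
  proof (induction i)
    case (Suc i)
    have "(3 :: nat) ^ (2 * Suc i + 1) = 9 * 3 ^ (2 * i + 1)" by simp
    with Suc show ?case by presburger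
  qed simp
  then have "4 dvd (3 :: nat) ^ j + 1"
    using True by (metis oddE)
  moreover have "(3 :: nat) ^ (j + 2) = 9 * 3 ^ j" by simp
  ultimately have "(3 ^ (j + 2) + 1) div 4 = 3 ^ j * 2 + (3 ^ j + 1) div (4 :: nat)"
    by presburger
  then show ?thesis using True by (simp add: offset_def)
qed (simp add: offset_def)

text \<open>Each step trisects the previous series: 3^(j+1) n + offset (j+1) is 3^j (3 n + r) +
  offset j. The two families of terms are exchanged, and the coefficients are multiplied by the
  matrix that defines the next row of a.\<close>

lemma p13_section:
  assumes "j \<ge> 1"
  shows "Abs_fps (\<lambda>n. p13 (3 ^ j * n + offset j)) =
    (\<Sum>l<4 ^ j. of_int (a_mat j (Suc l)) * (if odd j then odd_term l else even_term l))"
  using assms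
proof (induction j rule: dec_induct)
  case base
  have "Abs_fps (\<lambda>n. p13 (3 ^ 1 * n + offset 1)) = fps_part 1 (1 / euler_prod 1 ^ 6)"
    by (simp add: fps_eq_iff p13_def offset_def)
  also have "\<dots> = (\<Sum>l\<in>{0, 1}. of_int (a_mat 1 (Suc l)) * odd_term l)"
    unfolding part_generating_function by simp
  also have "\<dots> = (\<Sum>l<4 ^ 1. of_int (a_mat 1 (Suc l)) * odd_term l)"
    by (intro sum.mono_neutral_left) auto
  finally show ?case by simp
next
  case (step j)
  let ?r = "if odd j then 2 else 0" and ?t = "\<lambda>j. if odd j then odd_term else even_term"
  let ?m = "\<lambda>l k. m_mat (if odd j then 4 * Suc l else 4 * Suc l + 2) (Suc l + Suc k)"
  have part: "fps_part ?r (?t j l) = (\<Sum>k<4 ^ Suc j. of_int (?m l k) * ?t (Suc j) k)"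
    if "l < 4 ^ j" for l
  proof -
    have "3 * Suc l + 2 \<le> 4 ^ Suc j"
    proof -
      \<comment> \<open>From l + 1 \<le> 4^j and 4^j \<ge> 2 it follows that 3 (l + 1) + 2 \<le> 4 *
        4^j.\<close>
      have "(4 :: nat) ^ j \<ge> 4 ^ 1" using step.hyps by (intro power_increasing) auto
      then show ?thesis using that by simp
    qed
    then show ?thesis
      using part_odd_term[of l "4 ^ Suc j"] part_even_term[of l "4 ^ Suc j"] by (cases "odd j") simp_all
  qed
  have "Abs_fps (\<lambda>n. p13 (3 ^ Suc j * n + offset (Suc j))) = fps_part ?r (Abs_fps (\<lambda>n. p13 (3 ^ j * n + offset j)))"
    by (simp add: fps_eq_iff offset_Suc algebra_simps)
  also have "\<dots> = (\<Sum>l<4 ^ j. of_int (a_mat j (Suc l)) * fps_part ?r (?t j l))"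
    unfolding step.IH fps_part_sum by (intro sum.cong refl) (simp add: fps_part_of_int_mult)
  also have "\<dots> = (\<Sum>l<4 ^ j. \<Sum>k<4 ^ Suc j. of_int (a_mat j (Suc l) * ?m l k) * ?t (Suc j) k)"
    by (intro sum.cong refl) (simp only: part sum_distrib_left lessThan_iff of_int_mult mult.assoc)
  also have "\<dots> = (\<Sum>k<4 ^ Suc j. \<Sum>l<4 ^ j. of_int (a_mat j (Suc l) * ?m l k) * ?t (Suc j) k)"
    by (rule sum.swap)
  also have "\<dots> = (\<Sum>k<4 ^ Suc j. of_int (a_mat (Suc j) (Suc k)) * ?t (Suc j) k)"
    unfolding a_mat_Suc[OF step.hyps(1)] by (simp only: of_int_sum sum_distrib_right)
  finally show ?case by (simp only: if_distribR)
qed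

theorem theorem3p1:
  fixes j :: nat
  assumes "j \<ge> 1"
  shows "(\<lambda>l. fps_const (of_int (a_mat (2 * j - 1) (Suc l))) * fps_X ^ l
              * (euler_prod 3 ^ (12 * Suc l - 6) / euler_prod 1 ^ (12 * Suc l)))
           sums Abs_fps (\<lambda>n. p13 (3 ^ (2 * j - 1) * n + (3 ^ (2 * j - 1) + 1) div 4))
       \<and> (\<lambda>l. fps_const (of_int (a_mat (2 * j) (Suc l))) * fps_X ^ l
              * (euler_prod 3 ^ (12 * Suc l) / euler_prod 1 ^ (12 * Suc l + 6)))
           sums Abs_fps (\<lambda>n. p13 (3 ^ (2 * j) * n + (3 ^ (2 * j + 1) + 1) div 4))"
proof -
  have sums: "(\<lambda>l. of_int (a_mat i (Suc l)) * (if odd i then odd_term l else even_term l))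
      sums Abs_fps (\<lambda>n. p13 (3 ^ i * n + offset i))" if "i \<ge> 1" for i
    unfolding p13_section[OF that]
  \<comment> \<open>Only the first 4^i terms can be nonzero, so the infinite series is the finite
    sum of \<open>p13_section\<close>.\<close>
  proof (rule sums_finite)
    fix l :: nat assume "l \<notin> {..<4 ^ i}"
    then have "a_mat i (Suc l) = 0"
      using a_mat_support[of i "Suc l"] by force
    then show "of_int (a_mat i (Suc l)) * (if odd i then odd_term l else even_term l) = 0"
      by simp
  qed simp
  have "odd (2 * j - 1)" using assms by simp
  with sums[of "2 * j - 1"] sums[of "2 * j"] assms show ?thesis
    by (simp only: odd_term_def even_term_def offset_def fps_of_int mult.assoc if_True if_False) simp
qed

end
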